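(* Let $f_1,\dots,f_n:\mathbb{R}^d\to\mathbb{R}$ be functions and $f=\frac1n\sum_{i=1}^n f_i$. Assume: (i) each $f_i$ is differentiable and bounded from below; (ii) there exists $x\in\mathbb{R}^d$ with $\nabla f_i(x)=0$ for all $i\in\{1,\dots,n\}$; (iii) each $f_i$ is convex; (iv) each $f_i$ is $L_i$-smooth with $L_i>0$, and $L_{\max}=\max_i L_i$; (v) $f$ is $\mu$-strongly convex with $\mu>0$. Let $\gamma>0$, $x_0\in\mathbb{R}^d$, $0\le\varepsilon_2<\frac{\mu^2}{4L_{\max}^2}$, and let $\alpha$ satisfy $$0<\alpha\le\frac{1}{\gamma L_\gamma}\cdot\frac{\mu-2\sqrt{\varepsilon_2}L_{\max}}{\mu+4\sqrt{\varepsilon_2}L_{\max}+4\varepsilon_2L_{\max}},$$ where $L_\gamma$ is the smoothness constant of $M^\gamma$. Let the iterates be generated by $$x_{k+1}=x_k+\alpha\left(\frac1n\sum_{i=1}^n\tilde x_{i,k+1}-x_k\right),\qquad k=0,1,2,\dots,$$ where for every $k$ and every $i$ the point $\tilde x_{i,k+1}\in\mathbb{R}^d$ satisfies $\|\tilde x_{i,k+1}-\mathrm{prox}_{\gamma f_i}(x_k)\|^2\le\varepsilon_2\|x_k-\mathrm{prox}_{\gamma f_i}(x_k)\|^2$. Then for every $K\ge0$, $$\mathcal{E}_K\le\left(1-\alpha\cdot\frac{\gamma(\mu-2\sqrt{\varepsilon_2}L_{\max})}{4(1+\gamma L_{\max})}\right)^K\mathcal{E}_0,$$ where $\mathcal{E}_k=\gamma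 M^\gamma(x_k)-\gamma\inf M^\gamma$. In particular, if $\alpha$ is chosen as the largest value allowed above, then $$\Delta_K\le\left(1-\frac{\mu}{4L_\gamma(1+\gamma L_{\max})}\cdot S(\varepsilon_2)\right)^K\cdot\frac{L_\gamma(1+\gamma L_{\max})}{\mu}\,\Delta_0,$$ where $\Delta_k=\|x_k-x_\star\|^2$ with $x_\star$ a minimizer of $f$, and $$S(\varepsilon_2)=\frac{(\mu-2\sqrt{\varepsilon_2}L_{\max})\left(1-2\sqrt{\varepsilon_2}\frac{L_{\max}}{\mu}\right)}{\mu+4\sqrt{\varepsilon_2}L_{\max}+4\varepsilon_2L_{\max}}$$ satisfies $0<S(\varepsilon_2)\le1$.
   Context: $\|\cdot\|$ is the Euclidean norm. $\phi$ is $L$-smooth if $\phi(x)-\phi(y)-\langle\nabla\phi(y),x-y\rangle\le\frac L2\|x-y\|^2$ for all $x,y\in\mathbb{R}^d$; $f$ is $\mu$-strongly convex if $f(x)-f(y)-\langle\nabla f(y),x-y\rangle\ge\frac\mu2\|x-y\|^2$ for all $x,y$. For convex $\phi:\mathbb{R}^d\to\mathbb{R}$ and $\gamma>0$, the proximal operator is $\mathrm{prox}_{\gamma\phi}(x)=\arg\min_{z}\{\phi(z)+\frac1{2\gamma}\|z-x\|^2\}$ and the Moreau envelope is $M^\gamma_\phi(x)=\min_z\{\phi(z)+\frac1{2\gamma}\|z-x\|^2\}$. Set $M^\gamma(x)=\frac1n\sum_{i=1}^n M^\gamma_{f_i}(x)$; this function is convex and smooth, and $L_\gamma$ denotes its smoothness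 constant (the smallest $L$ for which $M^\gamma$ is $L$-smooth). The iteration is the inexact FedExProx algorithm with constant extrapolation parameter $\alpha$. *)

theory Defs
  imports "HOL-Analysis.Analysis"
begin

text \<open>
  \<open>THE D. GDERIV \<phi> y :> D\<close> is the gradient wherever it exists; at points where
  \<open>\<phi>\<close> is not differentiable its value is unspecified.  The predicates below
  therefore require differentiability explicitly.
\<close>

definition gradient :: "('a::real_inner \<Rightarrow> real) \<Rightarrow> 'a \<Rightarrow> 'a" where
  "gradient \<phi> y = (THE D. GDERIV \<phi> y :> D)"

lemma gradient_eqI:
  assumes "GDERIV \<phi> y :> D"
  shows "gradient \<phi> y = D"
  unfolding gradient_def
proof (rule the_equality)
  show "GDERIV \<phi> y :> D" by fact
next
  fix D' assume "GDERIV \<phi> y :> D'"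
  with assms have "(\<lambda>h. inner h D') = (\<lambda>h. inner h D)"
    unfolding gderiv_def by (blast intro: has_derivative_unique)
  then have "inner (D' - D) (D' - D) = 0"
    by (metis inner_diff_right right_minus_eq)
  then show "D' = D" by simp
qed

lemma GDERIV_gradient:
  fixes \<phi> :: "'a::euclidean_space \<Rightarrow> real"
  assumes "\<phi> differentiable (at y)"
  shows "GDERIV \<phi> y :> gradient \<phi> y"
proof -
  obtain T where T: "(\<phi> has_derivative T) (at y)"
    using assms unfolding differentiable_def by blast
  then have lin: "linear T" by (rule has_derivative_linear)
  have "T = (\<lambda>h. inner h (adjoint T 1))"
    using adjoint_works[OF lin, of _ 1] by (auto simp: fun_eq_iff)
  with T have "GDERIV \<phi> y :> adjoint T 1"
    unfolding gderiv_def by metis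
  then show ?thesis by (metis gradient_eqI)
qed

definition L_smooth :: "real \<Rightarrow> ('a::real_inner \<Rightarrow> real) \<Rightarrow> bool" where
  "L_smooth L \<phi> \<longleftrightarrow> (\<forall>x. \<phi> differentiable (at x)) \<and>
     (\<forall>x y. \<phi> x - \<phi> y - inner (gradient \<phi> y) (x - y) \<le> L / 2 * (norm (x - y))\<^sup>2)"

definition strongly_convex :: "real \<Rightarrow> ('a::real_inner \<Rightarrow> real) \<Rightarrow> bool" where
  "strongly_convex \<mu> \<phi> \<longleftrightarrow> (\<forall>x. \<phi> differentiable (at x)) \<and>
     (\<forall>x y. \<phi> x - \<phi> y - inner (gradient \<phi> y) (x - y) \<ge> \<mu> / 2 * (norm (x - y))\<^sup>2)"

text \<open>
  The least \<open>L\<close> exists for every convex function that is \<open>L\<close>-smooth for some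
  \<open>L\<close>; otherwise the value is unspecified.
\<close>

definition smoothness_constant :: "('a::real_inner \<Rightarrow> real) \<Rightarrow> real" where
  "smoothness_constant \<phi> = (LEAST L. L_smooth L \<phi>)"

text \<open>
  For convex \<open>\<phi>\<close> on a Euclidean space and \<open>\<gamma> > 0\<close>, the objective
  below has exactly one minimizer, so \<open>prox \<gamma> \<phi> x\<close> does not depend on a choice and
  the infimum in \<open>moreau\<close> is a minimum.
\<close>

definition prox :: "real \<Rightarrow> ('a::real_inner \<Rightarrow> real) \<Rightarrow> 'a \<Rightarrow> 'a" where
  "prox \<gamma> \<phi> x = arg_min (\<lambda>z. \<phi> z + 1 / (2 * \<gamma>) * (norm (z - x))\<^sup>2) (\<lambda>z. True)"

definition moreau :: "real \<Rightarrow> ('a::real_inner \<Rightarrow> real) \<Rightarrow> 'a \<Rightarrow> real" where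
  "moreau \<gamma> \<phi> x = (INF z. \<phi> z + 1 / (2 * \<gamma>) * (norm (z - x))\<^sup>2)"

definition average :: "nat \<Rightarrow> (nat \<Rightarrow> 'a \<Rightarrow> real) \<Rightarrow> 'a \<Rightarrow> real" where
  "average n g x = 1 / real n * (\<Sum>i=1..n. g i x)"

end

theory Submission
  imports Defs
begin

text \<open>
  At a common stationary point \<open>w\<close> all \<open>f i\<close> and all their Moreau envelopes attain their
  minima. Each envelope has gradient \<open>(x - prox x) / \<gamma>\<close>, and \<open>L\<close>-smoothness of \<open>f i\<close> gives
  \<open>f i x - min \<le> (1 + \<gamma> * L) * (envelope x - min)\<close>, so \<open>M\<close> inherits quadratic growth from the
  strong convexity of the average of the \<open>f i\<close>. Convexity turns quadratic growth into gradient
  dominance. The latter also bounds the mean of the squared residuals \<open>x - prox x\<close> by a multiple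
  of the squared norm of the mean residual, which makes the inexactness a relative error of the
  gradient step on \<open>M\<close>; the descent inequality then contracts the gap of \<open>M\<close>.
\<close>

section \<open>Tangent inequalities and smoothness constants\<close>

text \<open>Restriction to the line through \<open>x\<close> and \<open>y\<close> reduces this to
  the tangent inequality for convex functions of one real variable.\<close>

lemma convex_on_gradient_ineq:
  fixes \<phi> :: "'a::euclidean_space \<Rightarrow> real"
  assumes "convex_on UNIV \<phi>" "\<phi> differentiable (at x)"
  shows "\<phi> x + inner (gradient \<phi> x) (y - x) \<le> \<phi> y"
proof -
  define g where "g = (\<lambda>t::real. \<phi> (x + t *\<^sub>R (y - x)))"
  have "convex_on UNIV g"
  proof (rule convex_onI)
    fix t a b :: real assume t: "0 < t" "t < 1"
    have "x + ((1 - t) *\<^sub>R a + t *\<^sub>R b) *\<^sub>R (y - x)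
        = (1 - t) *\<^sub>R (x + a *\<^sub>R (y - x)) + t *\<^sub>R (x + b *\<^sub>R (y - x))"
      by (simp add: algebra_simps)
    then show "g ((1 - t) *\<^sub>R a + t *\<^sub>R b) \<le> (1 - t) * g a + t * g b"
      unfolding g_def using convex_onD[OF assms(1)] t by (metis UNIV_I less_imp_le)
  qed simp
  moreover have "(g has_field_derivative inner (gradient \<phi> x) (y - x)) (at 0)"
  proof -
    have "(\<phi> has_derivative (\<lambda>h. inner h (gradient \<phi> x))) (at (x + 0 *\<^sub>R (y - x)))"
      using GDERIV_gradient[OF assms(2)] by (simp add: gderiv_def)
    moreover have "((\<lambda>t. x + t *\<^sub>R (y - x)) has_derivative (\<lambda>t. t *\<^sub>R (y - x))) (at 0)"
      by (auto intro!: derivative_eq_intros)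
    ultimately have "(g has_derivative (\<lambda>t. inner (t *\<^sub>R (y - x)) (gradient \<phi> x))) (at 0)"
      unfolding g_def using has_derivative_compose by blast
    then show ?thesis
      by (simp add: has_field_derivative_def inner_commute mult.commute[of _ "inner _ _"])
  qed
  ultimately have "g 1 - g 0 \<ge> inner (gradient \<phi> x) (y - x) * (1 - 0)"
    by (intro convex_on_imp_above_tangent[where A=UNIV]) auto
  then show ?thesis by (simp add: g_def)
qed

text \<open>Serves the Moreau envelope: its tangent error has quadratic bounds on both sides, so its
  gradient is found without differentiating \<open>prox\<close>.\<close>

lemma GDERIV_of_quadratic_error:
  fixes \<phi> :: "'a::real_inner \<Rightarrow> real"
  assumes err: "\<And>y. \<bar>\<phi> y - \<phi> x - inner D (y - x)\<bar> \<le> C * (norm (y - x))\<^sup>2"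
  shows "GDERIV \<phi> x :> D"
  unfolding gderiv_def has_derivative_at_alt
proof (intro conjI allI impI)
  show "bounded_linear (\<lambda>h. inner h D)" by (rule bounded_linear_inner_left)
next
  fix e :: real assume "e > 0"
  \<comment> \<open>No sign is assumed for \<open>C\<close>; the denominator
    \<open>\<bar>C\<bar> + 1\<close> is positive and dominates \<open>C\<close>.\<close>
  define d where "d = e / (\<bar>C\<bar> + 1)"
  have "norm (\<phi> y - \<phi> x - inner (y - x) D) \<le> e * norm (y - x)" if "norm (y - x) < d" for y
  proof -
    have "norm (\<phi> y - \<phi> x - inner (y - x) D) \<le> C * (norm (y - x))\<^sup>2"
      using err[of y] by (simp only: real_norm_def inner_commute)
    also have "\<dots> \<le> (\<bar>C\<bar> + 1) * (norm (y - x))\<^sup>2"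
      by (intro mult_right_mono) auto
    also have "\<dots> = ((\<bar>C\<bar> + 1) * norm (y - x)) * norm (y - x)"
      by (simp add: power2_eq_square)
    also have "\<dots> \<le> e * norm (y - x)"
    proof (rule mult_right_mono)
      have "norm (y - x) \<le> e / (\<bar>C\<bar> + 1)"
        using that by (simp add: d_def)
      then have "norm (y - x) * (\<bar>C\<bar> + 1) \<le> e"
        using pos_le_divide_eq[of "\<bar>C\<bar> + 1"] by simp
      then show "(\<bar>C\<bar> + 1) * norm (y - x) \<le> e" by (simp add: mult.commute)
    qed simp
    finally show ?thesis .
  qed
  moreover have "d > 0" using \<open>e > 0\<close> by (simp add: d_def)
  ultimately show "\<exists>d>0. \<forall>y. norm (y - x) < d \<longrightarrow>
      norm (\<phi> y - \<phi> x - inner (y - x) D) \<le> e * norm (y - x)" by blast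
qed

lemma L_smooth_mono:
  assumes "L_smooth L \<phi>" "L \<le> L'"
  shows "L_smooth L' \<phi>"
proof -
  have "L / 2 * (norm (x - y))\<^sup>2 \<le> L' / 2 * (norm (x - y))\<^sup>2" for x y :: 'a
    using assms(2) by (intro mult_right_mono) auto
  then show ?thesis using assms(1) unfolding L_smooth_def by (meson order_trans)
qed

text \<open>\<open>LEAST\<close> over the reals is informative only when the infimum is attained.
  Here it is: for fixed points the smoothness inequality is a closed condition on the constant, so
  it passes to the infimum, and convexity bounds the admissible constants below by 0.\<close>

lemma L_smooth_smoothness_constant:
  fixes \<phi> :: "'a::euclidean_space \<Rightarrow> real"
  assumes "L_smooth L \<phi>"
    and conv: "\<And>x y. \<phi> x + inner (gradient \<phi> x) (y - x) \<le> \<phi> y"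
  shows "L_smooth (smoothness_constant \<phi>) \<phi>" "0 \<le> smoothness_constant \<phi>"
proof -
  define A where "A = {L. L_smooth L \<phi>}"
  have nonneg: "0 \<le> L'" if "L_smooth L' \<phi>" for L'
  proof -
    \<comment> \<open>A Euclidean space is nontrivial; without a nonzero vector every real would be
      admissible.\<close>
    obtain b :: 'a where b: "norm b = 1" using nonempty_Basis norm_Basis by blast
    have "\<phi> b - \<phi> 0 - inner (gradient \<phi> 0) (b - 0) \<le> L' / 2 * (norm (b - 0))\<^sup>2"
      using that unfolding L_smooth_def by blast
    then show ?thesis using conv[of 0 b] b by simp
  qed
  then have bdd: "bdd_below A" by (auto simp: A_def bdd_below_def)
  have smooth: "L_smooth (Inf A) \<phi>"
    unfolding L_smooth_def
  proof (intro conjI allI)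
    fix x y
    show "\<phi> x - \<phi> y - inner (gradient \<phi> y) (x - y) \<le> Inf A / 2 * (norm (x - y))\<^sup>2"
    proof (cases "x = y")
      case False
      then have n: "(norm (x - y))\<^sup>2 > 0" by simp
      have "2 * (\<phi> x - \<phi> y - inner (gradient \<phi> y) (x - y)) / (norm (x - y))\<^sup>2 \<le> Inf A"
      proof (rule cInf_greatest)
        show "A \<noteq> {}" using assms by (auto simp: A_def)
      next
        fix L' assume "L' \<in> A"
        then have "\<phi> x - \<phi> y - inner (gradient \<phi> y) (x - y) \<le> L' / 2 * (norm (x - y))\<^sup>2"
          by (simp add: A_def L_smooth_def)
        then show "2 * (\<phi> x - \<phi> y - inner (gradient \<phi> y) (x - y)) / (norm (x - y))\<^sup>2 \<le> L'"
          using n by (simp add: pos_divide_le_eq)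
      qed
      then show ?thesis using n by (simp add: pos_divide_le_eq)
    qed simp
  qed (use assms in \<open>auto simp: L_smooth_def\<close>)
  have "smoothness_constant \<phi> = Inf A"
    unfolding smoothness_constant_def
    by (rule Least_equality) (use smooth bdd in \<open>auto simp: A_def intro: cInf_lower\<close>)
  then show "L_smooth (smoothness_constant \<phi>) \<phi>" "0 \<le> smoothness_constant \<phi>"
    using smooth nonneg by auto
qed

text \<open>A gradient step of length \<open>1 / L\<close> lowers \<open>\<phi>\<close> by at least
  the squared gradient norm over \<open>2 * L\<close>, and it cannot go below
  \<open>\<phi> w\<close>.\<close>

lemma norm_gradient_le_gap:
  fixes \<phi> :: "'a::real_inner \<Rightarrow> real"
  assumes "L_smooth L \<phi>" "L > 0" and min: "\<And>z. \<phi> w \<le> \<phi> z"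
  shows "(norm (gradient \<phi> x))\<^sup>2 \<le> 2 * L * (\<phi> x - \<phi> w)"
proof -
  let ?g = "gradient \<phi> x"
  let ?z = "x - (1 / L) *\<^sub>R ?g"
  have "\<phi> ?z - \<phi> x - inner ?g (?z - x) \<le> L / 2 * (norm (?z - x))\<^sup>2"
    using assms(1) unfolding L_smooth_def by blast
  also have "inner ?g (?z - x) = - ((norm ?g)\<^sup>2 / L)"
    by (simp add: power2_norm_eq_inner)
  also have "L / 2 * (norm (?z - x))\<^sup>2 = (norm ?g)\<^sup>2 / L / 2"
    using \<open>L > 0\<close> by (simp add: power_divide power2_eq_square)
  finally have "(norm ?g)\<^sup>2 / L / 2 \<le> \<phi> x - \<phi> w"
    using min[of ?z] by linarith
  then show ?thesis using \<open>L > 0\<close> by (simp add: field_simps)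
qed

section \<open>Averages of differentiable functions\<close>

lemma GDERIV_average:
  assumes "\<And>i. i \<in> {1..n} \<Longrightarrow> GDERIV (g i) x :> D i"
  shows "GDERIV (average n g) x :> (1 / real n) *\<^sub>R (\<Sum>i=1..n. D i)"
proof -
  have "((\<lambda>y. 1 / real n * (\<Sum>i=1..n. g i y)) has_derivative
      (\<lambda>h. 1 / real n * (\<Sum>i=1..n. inner h (D i)))) (at x)"
    using assms unfolding gderiv_def by (intro has_derivative_mult_right has_derivative_sum) auto
  then show ?thesis
    by (simp add: gderiv_def average_def[abs_def] inner_sum_right)
qed

lemma gradient_average:
  fixes g :: "nat \<Rightarrow> 'a::euclidean_space \<Rightarrow> real"
  assumes "\<And>i. i \<in> {1..n} \<Longrightarrow> g i differentiable (at x)"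
  shows "gradient (average n g) x = (1 / real n) *\<^sub>R (\<Sum>i=1..n. gradient (g i) x)"
  using assms by (intro gradient_eqI GDERIV_average GDERIV_gradient)

lemma average_differentiable:
  fixes g :: "nat \<Rightarrow> 'a::euclidean_space \<Rightarrow> real"
  assumes "\<And>i. i \<in> {1..n} \<Longrightarrow> g i differentiable (at x)"
  shows "average n g differentiable (at x)"
  unfolding differentiable_def
  using GDERIV_average[of n g x, OF GDERIV_gradient, OF assms] unfolding gderiv_def by blast

text \<open>Tangent errors are linear in the function, so smoothness and convexity bounds for an
  average reduce to those of the summands.\<close>

lemma average_tangent_error:
  fixes g :: "nat \<Rightarrow> 'a::euclidean_space \<Rightarrow> real"
  assumes "\<And>i. i \<in> {1..n} \<Longrightarrow> g i differentiable (at y)"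
  shows "average n g x - average n g y - inner (gradient (average n g) y) h
    = 1 / real n * (\<Sum>i=1..n. g i x - g i y - inner (gradient (g i) y) h)"
proof -
  have "gradient (average n g) y = (1 / real n) *\<^sub>R (\<Sum>i=1..n. gradient (g i) y)"
    using assms by (rule gradient_average)
  then show ?thesis
    by (simp add: average_def sum_subtractf inner_sum_left diff_divide_distrib)
qed

lemma mean_le_bound:
  assumes "n \<ge> 1" "\<And>i. i \<in> {1..n} \<Longrightarrow> a i \<le> (c::real)"
  shows "1 / real n * (\<Sum>i=1..n. a i) \<le> c"
  using sum_bounded_above[of "{1..n}" a c] assms by (simp add: field_simps)

lemma L_smooth_average:
  fixes g :: "nat \<Rightarrow> 'a::euclidean_space \<Rightarrow> real"
  assumes "n \<ge> 1" "\<And>i. i \<in> {1..n} \<Longrightarrow> L_smooth L (g i)"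
  shows "L_smooth L (average n g)"
proof -
  have diff: "\<And>i z. i \<in> {1..n} \<Longrightarrow> g i differentiable (at z)"
    using assms(2) by (simp add: L_smooth_def)
  have "average n g x - average n g y - inner (gradient (average n g) y) (x - y)
      \<le> L / 2 * (norm (x - y))\<^sup>2" for x y
  proof -
    have "average n g x - average n g y - inner (gradient (average n g) y) (x - y)
        = 1 / real n * (\<Sum>i=1..n. g i x - g i y - inner (gradient (g i) y) (x - y))"
      using diff by (rule average_tangent_error)
    also have "\<dots> \<le> L / 2 * (norm (x - y))\<^sup>2"
      using assms(1) by (rule mean_le_bound) (use assms(2) in \<open>simp add: L_smooth_def\<close>)
    finally show ?thesis .
  qed
  then show ?thesis using average_differentiable[of n g, OF diff] by (simp add: L_smooth_def)
qed

lemma average_tangent_le: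
  fixes g :: "nat \<Rightarrow> 'a::euclidean_space \<Rightarrow> real"
  assumes "\<And>i z. i \<in> {1..n} \<Longrightarrow> g i differentiable (at z)"
    and "\<And>i. i \<in> {1..n} \<Longrightarrow> g i x + inner (gradient (g i) x) (y - x) \<le> g i y"
  shows "average n g x + inner (gradient (average n g) x) (y - x) \<le> average n g y"
proof -
  have "0 \<le> 1 / real n * (\<Sum>i=1..n. g i y - g i x - inner (gradient (g i) x) (y - x))"
    using assms(2) by (intro mult_nonneg_nonneg sum_nonneg) (auto simp: algebra_simps)
  also have "\<dots> = average n g y - average n g x - inner (gradient (average n g) x) (y - x)"
    using assms(1) by (rule average_tangent_error[symmetric])
  finally show ?thesis by simp
qed

lemma average_mono:
  assumes "\<And>i. i \<in> {1..n} \<Longrightarrow> g i x \<le> h i y"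
  shows "average n g x \<le> average n h y"
  unfolding average_def using assms by (intro mult_left_mono sum_mono) auto

text \<open>Triangle inequality followed by Cauchy-Schwarz; it passes from the individual prox
  errors to the error of their mean.\<close>

lemma norm_mean_power2_le:
  fixes v :: "nat \<Rightarrow> 'a::real_normed_vector"
  assumes "n \<ge> 1"
  shows "(norm ((1 / real n) *\<^sub>R (\<Sum>i=1..n. v i)))\<^sup>2 \<le> 1 / real n * (\<Sum>i=1..n. (norm (v i))\<^sup>2)"
proof -
  have "(norm (\<Sum>i=1..n. v i))\<^sup>2 \<le> (\<Sum>i=1..n. norm (v i))\<^sup>2"
    by (intro power_mono norm_sum) auto
  also have "\<dots> \<le> (\<Sum>i=1..n. (norm (v i))\<^sup>2) * real n"
    using sum_squared_le_sum_of_squares[of "\<lambda>i. norm (v i)" "{1..n}"] by simp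
  finally show ?thesis
    using assms by (simp add: power_divide power2_eq_square field_simps)
qed

subsection \<open>The Moreau envelope\<close>

lemma prox_is_arg_min:
  fixes \<phi> :: "'a::euclidean_space \<Rightarrow> real"
  assumes cont: "continuous_on UNIV \<phi>" and bdd: "bdd_below (range \<phi>)" and "\<gamma> > 0"
  shows "\<phi> (prox \<gamma> \<phi> x) + 1 / (2 * \<gamma>) * (norm (prox \<gamma> \<phi> x - x))\<^sup>2
      \<le> \<phi> z + 1 / (2 * \<gamma>) * (norm (z - x))\<^sup>2"
proof -
  define F where "F = (\<lambda>z. \<phi> z + 1 / (2 * \<gamma>) * (norm (z - x))\<^sup>2)"
  obtain b where b: "\<And>z. b \<le> \<phi> z" using bdd by (auto simp: bdd_below_def)
  \<comment> \<open>Outside this radius the quadratic term is at least \<open>\<phi> x - b\<close>,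
    so no point there beats the centre \<open>x\<close>, and compactness of the ball
    suffices.\<close>
  define R where "R = sqrt (2 * \<gamma> * (\<phi> x - b))"
  have R: "R\<^sup>2 = 2 * \<gamma> * (\<phi> x - b)" "R \<ge> 0"
    using b[of x] \<open>\<gamma> > 0\<close> by (auto simp: R_def)
  have "continuous_on (cball x R) F"
    unfolding F_def by (intro continuous_intros continuous_on_subset[OF cont]) auto
  then obtain p where p: "p \<in> cball x R" "\<And>z. z \<in> cball x R \<Longrightarrow> F p \<le> F z"
    using continuous_attains_inf[of "cball x R" F] R(2) by auto
  have "F p \<le> F z" for z
  proof (cases "z \<in> cball x R")
    case False
    then have "R\<^sup>2 \<le> (norm (z - x))\<^sup>2"
      using R(2) by (intro power_mono) (auto simp: dist_norm norm_minus_commute)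
    then have "\<phi> x - b \<le> 1 / (2 * \<gamma>) * (norm (z - x))\<^sup>2"
      using R(1) \<open>\<gamma> > 0\<close> by (simp add: field_simps)
    moreover have "F p \<le> F x" using p(2)[of x] R(2) by simp
    ultimately show ?thesis using b[of z] by (simp add: F_def)
  qed (use p in auto)
  then have "is_arg_min F (\<lambda>z. True) p" by (simp add: is_arg_min_linorder)
  \<comment> \<open>\<open>arg_min\<close> is a Hilbert choice, so the existence of \<open>p\<close>
    carries minimality over to it.\<close>
  then have "is_arg_min F (\<lambda>z. True) (arg_min F (\<lambda>z. True))"
    unfolding arg_min_def by (rule someI)
  then show ?thesis
    by (simp add: is_arg_min_linorder F_def prox_def)
qed

locale convex_moreau =
  fixes \<phi> :: "'a::euclidean_space \<Rightarrow> real" and \<gamma> :: real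
  assumes diff: "\<And>x. \<phi> differentiable (at x)"
    and bdd: "bdd_below (range \<phi>)"
    and convex: "convex_on UNIV \<phi>"
    and gamma: "\<gamma> > 0"
begin

lemma prox_min:
  "\<phi> (prox \<gamma> \<phi> x) + 1 / (2 * \<gamma>) * (norm (prox \<gamma> \<phi> x - x))\<^sup>2
    \<le> \<phi> z + 1 / (2 * \<gamma>) * (norm (z - x))\<^sup>2"
  using diff bdd gamma
  by (intro prox_is_arg_min) (auto intro!: continuous_at_imp_continuous_on
      differentiable_imp_continuous_within)

lemma moreau_le: "moreau \<gamma> \<phi> x \<le> \<phi> z + 1 / (2 * \<gamma>) * (norm (z - x))\<^sup>2"
  unfolding moreau_def using prox_min by (intro cINF_lower) (auto simp: bdd_below_def)

lemma moreau_eq: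
  "moreau \<gamma> \<phi> x = \<phi> (prox \<gamma> \<phi> x) + 1 / (2 * \<gamma>) * (norm (x - prox \<gamma> \<phi> x))\<^sup>2"
  unfolding moreau_def norm_minus_commute[of x]
  by (rule cInf_eq_minimum) (use prox_min in auto)

text \<open>First-order optimality: the gradient of the prox objective vanishes at its
  minimizer.\<close>

lemma gradient_prox: "gradient \<phi> (prox \<gamma> \<phi> x) = (1 / \<gamma>) *\<^sub>R (x - prox \<gamma> \<phi> x)"
proof -
  let ?p = "prox \<gamma> \<phi> x"
  let ?F = "\<lambda>z. \<phi> z + 1 / (2 * \<gamma>) * (norm (z - x))\<^sup>2"
  let ?D = "gradient \<phi> ?p + (1 / \<gamma>) *\<^sub>R (?p - x)"
  have "((\<lambda>z. \<phi> z + 1 / (2 * \<gamma>) * inner (z - x) (z - x)) has_derivative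
      (\<lambda>h. inner h (gradient \<phi> ?p) + 1 / (2 * \<gamma>) * (inner (?p - x) h + inner h (?p - x)))) (at ?p)"
    using GDERIV_gradient[OF diff[of ?p]] unfolding gderiv_def
    by (intro has_derivative_add has_derivative_mult_right) (auto intro!: derivative_eq_intros)
  also have "(\<lambda>h. inner h (gradient \<phi> ?p) + 1 / (2 * \<gamma>) * (inner (?p - x) h + inner h (?p - x)))
      = (\<lambda>h. inner h ?D)"
    by (simp add: fun_eq_iff inner_add_right inner_commute[of "?p - x"])
  finally have "(?F has_derivative (\<lambda>h. inner h ?D)) (at ?p)"
    by (simp add: power2_norm_eq_inner)
  then have "(\<lambda>h. inner h ?D) = (\<lambda>h. 0)"
    using prox_min by (rule has_derivative_local_min[OF _ always_eventually[OF allI]])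
  then have "inner ?D ?D = 0" by metis
  then have "?D = 0" by simp
  then show ?thesis by (simp add: algebra_simps add_eq_0_iff)
qed

text \<open>The point \<open>prox \<gamma> \<phi> x\<close> is a competitor in the infimum defining
  the envelope at \<open>y\<close>.\<close>

lemma moreau_upper:
  "moreau \<gamma> \<phi> y - moreau \<gamma> \<phi> x - inner ((1 / \<gamma>) *\<^sub>R (x - prox \<gamma> \<phi> x)) (y - x)
    \<le> 1 / (2 * \<gamma>) * (norm (y - x))\<^sup>2"
proof -
  let ?p = "prox \<gamma> \<phi> x"
  have "(norm (?p - y))\<^sup>2 = (norm (x - ?p))\<^sup>2 + 2 * inner (x - ?p) (y - x) + (norm (y - x))\<^sup>2"
    by (simp add: power2_norm_eq_inner inner_diff_left inner_diff_right inner_commute)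
  then have "1 / (2 * \<gamma>) * (norm (?p - y))\<^sup>2 = 1 / (2 * \<gamma>) * (norm (x - ?p))\<^sup>2
      + 1 / \<gamma> * inner (x - ?p) (y - x) + 1 / (2 * \<gamma>) * (norm (y - x))\<^sup>2"
    using gamma by (simp add: field_simps)
  then show ?thesis
    unfolding inner_scaleR_left using moreau_le[of y ?p] moreau_eq[of x] by linarith
qed

text \<open>Convexity of \<open>\<phi>\<close> is applied between the two prox points, where
  \<open>gradient_prox\<close> supplies the slope.\<close>

lemma moreau_lower:
  "moreau \<gamma> \<phi> x + inner ((1 / \<gamma>) *\<^sub>R (x - prox \<gamma> \<phi> x)) (y - x) \<le> moreau \<gamma> \<phi> y"
proof -
  let ?p = "prox \<gamma> \<phi> x" and ?q = "prox \<gamma> \<phi> y"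
  have "\<phi> ?p + 1 / \<gamma> * inner (x - ?p) (?q - ?p) \<le> \<phi> ?q"
    using convex_on_gradient_ineq[OF convex diff, of ?p ?q] by (simp add: gradient_prox)
  \<comment> \<open>Completing the square leaves the squared difference of the two residuals as
    surplus, which is then dropped.\<close>
  moreover have "2 * inner (x - ?p) (?q - ?p) + (norm (y - ?q))\<^sup>2 - (norm (x - ?p))\<^sup>2
      = 2 * inner (x - ?p) (y - x) + (norm ((x - ?p) - (y - ?q)))\<^sup>2"
    by (simp add: power2_norm_eq_inner inner_diff_left inner_diff_right inner_commute)
  then have "2 * inner (x - ?p) (y - x)
      \<le> 2 * inner (x - ?p) (?q - ?p) + (norm (y - ?q))\<^sup>2 - (norm (x - ?p))\<^sup>2"
    by (metis le_add_same_cancel1 zero_le_power2)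
  then have "1 / (2 * \<gamma>) * (2 * inner (x - ?p) (y - x))
      \<le> 1 / (2 * \<gamma>) * (2 * inner (x - ?p) (?q - ?p) + (norm (y - ?q))\<^sup>2 - (norm (x - ?p))\<^sup>2)"
    using gamma by (intro mult_left_mono) auto
  then have "1 / \<gamma> * inner (x - ?p) (y - x) \<le> 1 / \<gamma> * inner (x - ?p) (?q - ?p)
      + 1 / (2 * \<gamma>) * (norm (y - ?q))\<^sup>2 - 1 / (2 * \<gamma>) * (norm (x - ?p))\<^sup>2"
    by (simp add: diff_divide_distrib add_divide_distrib)
  ultimately show ?thesis
    unfolding moreau_eq inner_scaleR_left by linarith
qed

lemma GDERIV_moreau: "GDERIV (moreau \<gamma> \<phi>) x :> (1 / \<gamma>) *\<^sub>R (x - prox \<gamma> \<phi> x)"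
proof (rule GDERIV_of_quadratic_error)
  fix y
  show "\<bar>moreau \<gamma> \<phi> y - moreau \<gamma> \<phi> x - inner ((1 / \<gamma>) *\<^sub>R (x - prox \<gamma> \<phi> x)) (y - x)\<bar>
      \<le> 1 / (2 * \<gamma>) * (norm (y - x))\<^sup>2"
    using moreau_upper[of y x] moreau_lower[of x y] by linarith
qed

lemma gradient_moreau: "gradient (moreau \<gamma> \<phi>) x = (1 / \<gamma>) *\<^sub>R (x - prox \<gamma> \<phi> x)"
  by (rule gradient_eqI) (rule GDERIV_moreau)

lemma L_smooth_moreau: "L_smooth (1 / \<gamma>) (moreau \<gamma> \<phi>)"
  unfolding L_smooth_def
proof (intro conjI allI)
  show "moreau \<gamma> \<phi> differentiable (at x)" for x
    using GDERIV_moreau unfolding gderiv_def differentiable_def by blast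
  show "moreau \<gamma> \<phi> x - moreau \<gamma> \<phi> y - inner (gradient (moreau \<gamma> \<phi>) y) (x - y)
      \<le> 1 / \<gamma> / 2 * (norm (x - y))\<^sup>2" for x y
    using moreau_upper[of x y] by (simp add: gradient_moreau mult.commute)
qed

end

section \<open>Envelopes of smooth functions with a stationary point\<close>

locale smooth_moreau = convex_moreau \<phi> \<gamma>
  for \<phi> :: "'a::euclidean_space \<Rightarrow> real" and \<gamma> +
  fixes L :: real and w :: 'a
  assumes smooth: "L_smooth L \<phi>" and L: "L > 0" and stationary: "gradient \<phi> w = 0"
begin

lemma minimizer: "\<phi> w \<le> \<phi> z"
  using convex_on_gradient_ineq[OF convex diff, of w z] stationary by simp

lemma moreau_ge_min: "\<phi> w \<le> moreau \<gamma> \<phi> x"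
  unfolding moreau_eq using minimizer gamma by (simp add: add_increasing2)

lemma moreau_minimizer: "moreau \<gamma> \<phi> w = \<phi> w"
  using moreau_le[of w w] moreau_ge_min[of w] by simp

text \<open>The residual is \<open>\<gamma>\<close> times the gradient of \<open>\<phi>\<close> at
  the prox point, where \<open>norm_gradient_le_gap\<close> applies.\<close>

lemma residual_le_gap:
  "(norm (x - prox \<gamma> \<phi> x))\<^sup>2 \<le> 2 * \<gamma>\<^sup>2 * L * (\<phi> (prox \<gamma> \<phi> x) - \<phi> w)"
proof -
  have "(norm (x - prox \<gamma> \<phi> x))\<^sup>2 / \<gamma>\<^sup>2 \<le> 2 * L * (\<phi> (prox \<gamma> \<phi> x) - \<phi> w)"
    using norm_gradient_le_gap[OF smooth L minimizer, of "prox \<gamma> \<phi> x"] gamma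
    by (simp add: gradient_prox power_divide)
  then show ?thesis using gamma by (simp add: field_simps)
qed

text \<open>The envelope gap is the gap of \<open>\<phi>\<close> at the prox point plus a multiple
  of the squared residual. Through \<open>residual_le_gap\<close> the first part yields the 1 in
  \<open>1 + \<gamma> * L\<close>; the second yields \<open>\<gamma> * L\<close>.\<close>

lemma residual_le_moreau_gap:
  "(1 + \<gamma> * L) * (norm (x - prox \<gamma> \<phi> x))\<^sup>2 \<le> 2 * L * \<gamma>\<^sup>2 * (moreau \<gamma> \<phi> x - \<phi> w)"
proof -
  have "2 * L * \<gamma>\<^sup>2 * (moreau \<gamma> \<phi> x - \<phi> w)
      = 2 * \<gamma>\<^sup>2 * L * (\<phi> (prox \<gamma> \<phi> x) - \<phi> w) + \<gamma> * L * (norm (x - prox \<gamma> \<phi> x))\<^sup>2"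
    using gamma unfolding moreau_eq by (simp add: field_simps power2_eq_square)
  then show ?thesis using residual_le_gap[of x] by (simp add: distrib_right)
qed

text \<open>Smoothness at the prox point puts the coefficient \<open>1 / \<gamma> + L / 2\<close> on
  the squared residual. The right-hand side accounts for all of it except
  \<open>1 / (2 * \<gamma>)\<close>, which \<open>residual_le_gap\<close> converts into a gap of
  \<open>\<phi>\<close>.\<close>

lemma gap_le_moreau_gap:
  "\<phi> x - \<phi> w \<le> (1 + \<gamma> * L) * (moreau \<gamma> \<phi> x - \<phi> w)"
proof -
  let ?p = "prox \<gamma> \<phi> x"
  have "\<phi> x - \<phi> ?p - inner (gradient \<phi> ?p) (x - ?p) \<le> L / 2 * (norm (x - ?p))\<^sup>2"
    using smooth unfolding L_smooth_def by blast
  then have "\<phi> x \<le> \<phi> ?p + (1 / \<gamma> + L / 2) * (norm (x - ?p))\<^sup>2"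
    by (simp add: gradient_prox power2_norm_eq_inner algebra_simps)
  moreover have "(norm (x - ?p))\<^sup>2 / (2 * \<gamma>) \<le> \<gamma> * L * (\<phi> ?p - \<phi> w)"
    using residual_le_gap[of x] gamma by (simp add: field_simps power2_eq_square)
  ultimately show ?thesis
    using gamma unfolding moreau_eq by (simp add: field_simps)
qed

end

subsection \<open>Descent of the inexact iteration\<close>

text \<open>Cauchy-Schwarz gives \<open>E \<le> norm g * norm v\<close>. After squaring, growth
  replaces \<open>norm v\<close> by \<open>E\<close>, and one factor \<open>E\<close>
  cancels.\<close>

lemma quadratic_growth_imp_gradient_dominance:
  fixes g v :: "'a::real_inner"
  assumes "0 \<le> E" "m / 2 * (norm v)\<^sup>2 \<le> E" "E \<le> inner g v" "m > 0"
  shows "m * E \<le> 2 * (norm g)\<^sup>2"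
proof (cases "E = 0")
  case False
  then have "E > 0" using assms by simp
  have "E \<le> norm g * norm v" using assms(3) norm_cauchy_schwarz order_trans by blast
  then have "E\<^sup>2 \<le> (norm g)\<^sup>2 * (norm v)\<^sup>2"
    using power_mono[OF _ assms(1), of "norm g * norm v" 2] by (simp add: power_mult_distrib)
  then have "m * E\<^sup>2 \<le> m * ((norm g)\<^sup>2 * (norm v)\<^sup>2)"
    using assms(4) by (intro mult_left_mono) auto
  also have "\<dots> = 2 * (norm g)\<^sup>2 * (m / 2 * (norm v)\<^sup>2)"
    by simp
  also have "\<dots> \<le> 2 * (norm g)\<^sup>2 * E"
    using assms(2) by (intro mult_left_mono) auto
  finally have "(m * E) * E \<le> (2 * (norm g)\<^sup>2) * E" by (simp add: power2_eq_square)
  then show ?thesis using \<open>E > 0\<close> by (simp only: mult_le_cancel_right_pos)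
qed simp

text \<open>To be used with \<open>g\<close> the mean residual, \<open>e\<close> the mean prox
  error, \<open>l\<close> the constant \<open>Lmax\<close> and
  \<open>\<Lambda> = \<gamma> * L\<gamma>\<close>. The linear term gains at least
  \<open>\<alpha> * (\<mu> - 2 * s * l) / \<mu>\<close> times the squared norm of \<open>g\<close>;
  the step condition lets the quadratic term consume at most half of that.\<close>

lemma inexact_gradient_step:
  fixes g e :: "'a::real_inner"
  assumes "0 < \<mu>" "\<mu> \<le> l" "0 \<le> s" "0 \<le> \<alpha>"
    and err: "(norm e)\<^sup>2 \<le> s\<^sup>2 * (4 * l / \<mu> * (norm g)\<^sup>2)"
    and step: "\<alpha> * \<Lambda> * (\<mu> + 4 * s * l + 4 * s\<^sup>2 * l) \<le> \<mu> - 2 * s * l" and "0 \<le> \<Lambda>"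
  shows "\<Lambda> / 2 * (norm (\<alpha> *\<^sub>R (g - e)))\<^sup>2 - inner g (\<alpha> *\<^sub>R (g - e))
    \<le> - (\<alpha> * (\<mu> - 2 * s * l) / (2 * \<mu>) * (norm g)\<^sup>2)"
proof -
  define G where "G = (norm g)\<^sup>2"
  have G: "0 \<le> G" by (simp add: G_def)
  \<comment> \<open>Weakening \<open>l / \<mu>\<close> to its square turns the error bound into a
    perfect square, so its root is linear in \<open>l\<close>.\<close>
  have "l / \<mu> \<le> (l / \<mu>)\<^sup>2"
    using assms(1,2) by (simp add: power2_eq_square field_simps)
  then have "s\<^sup>2 * (4 * (l / \<mu>) * G) \<le> s\<^sup>2 * (4 * (l / \<mu>)\<^sup>2 * G)"
    using G by (intro mult_left_mono mult_right_mono) auto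
  then have "(norm e)\<^sup>2 \<le> (2 * s * (l / \<mu>) * norm g)\<^sup>2"
    using err by (simp add: G_def power_mult_distrib power_divide algebra_simps)
  then have "norm e \<le> 2 * s * (l / \<mu>) * norm g"
    using assms(1-3) by (elim power2_le_imp_le) simp
  then have "norm g * norm e \<le> norm g * (2 * s * (l / \<mu>) * norm g)"
    by (intro mult_left_mono) auto
  then have "norm g * norm e \<le> 2 * s * l / \<mu> * G"
    by (simp add: G_def power2_eq_square mult_ac)
  moreover have "\<bar>inner g e\<bar> \<le> norm g * norm e" by (rule Cauchy_Schwarz_ineq2)
  ultimately have "\<bar>inner g e\<bar> \<le> 2 * s * l / \<mu> * G" by linarith
  then have ge: "\<bar>inner g e\<bar> * \<mu> \<le> 2 * s * l * G"
    using assms(1) by (simp add: field_simps)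
  \<comment> \<open>The unweakened bound is kept here; hence \<open>4 * s\<^sup>2 * l\<close> has
    only the first power of \<open>l\<close>.\<close>
  have e: "(norm e)\<^sup>2 * \<mu> \<le> 4 * s\<^sup>2 * l * G"
    using err assms(1) by (simp add: G_def field_simps)
  have "\<mu> * (norm (g - e))\<^sup>2 = \<mu> * G - 2 * (inner g e * \<mu>) + (norm e)\<^sup>2 * \<mu>"
    by (simp add: G_def power2_norm_eq_inner inner_diff_left inner_diff_right inner_commute
        algebra_simps)
  moreover have "- inner g e * \<mu> \<le> \<bar>inner g e\<bar> * \<mu>"
    using assms(1) by (intro mult_right_mono) auto
  ultimately have "\<mu> * (norm (g - e))\<^sup>2 \<le> (\<mu> + 4 * s * l + 4 * s\<^sup>2 * l) * G"
    using ge e by (simp add: algebra_simps)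
  then have "\<alpha> * \<Lambda> * (\<mu> * (norm (g - e))\<^sup>2) \<le> \<alpha> * \<Lambda> * ((\<mu> + 4 * s * l + 4 * s\<^sup>2 * l) * G)"
    using assms by (intro mult_left_mono) auto
  also have "\<dots> \<le> (\<mu> - 2 * s * l) * G"
    using mult_right_mono[OF step G] by (simp add: mult_ac)
  finally have q: "\<alpha> * \<Lambda> * (\<mu> * (norm (g - e))\<^sup>2) \<le> (\<mu> - 2 * s * l) * G" .
  have "inner g e * \<mu> \<le> \<bar>inner g e\<bar> * \<mu>"
    using assms(1) by (intro mult_right_mono) auto
  then have i: "(\<mu> - 2 * s * l) * G \<le> \<mu> * inner g (g - e)"
    using ge by (simp add: G_def power2_norm_eq_inner inner_diff_right algebra_simps)
  have "\<alpha> * (\<alpha> * \<Lambda> * (\<mu> * (norm (g - e))\<^sup>2)) + \<alpha> * (2 * ((\<mu> - 2 * s * l) * G))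
      \<le> \<alpha> * ((\<mu> - 2 * s * l) * G) + \<alpha> * (2 * (\<mu> * inner g (g - e)))"
    using q i assms(4) by (intro add_mono mult_left_mono) auto
  moreover have "(norm (\<alpha> *\<^sub>R (g - e)))\<^sup>2 = \<alpha> * \<alpha> * (norm (g - e))\<^sup>2"
    by (simp add: power_mult_distrib power2_eq_square)
  ultimately have "2 * \<mu> * (\<Lambda> / 2 * (norm (\<alpha> *\<^sub>R (g - e)))\<^sup>2 - inner g (\<alpha> *\<^sub>R (g - e)))
      \<le> - (\<alpha> * (\<mu> - 2 * s * l) * G)"
    by (simp only: inner_scaleR_right) (simp add: algebra_simps)
  also have "\<dots> = 2 * \<mu> * - (\<alpha> * (\<mu> - 2 * s * l) / (2 * \<mu>) * G)"
    using assms(1) by simp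
  finally show ?thesis
    using assms(1) by (simp only: G_def mult_le_cancel_left_pos[of "2 * \<mu>"] mult_pos_pos zero_less_numeral)
qed

text \<open>The sign of \<open>\<rho>\<close> is not known in advance. A negative factor forces
  \<open>E 0 = 0\<close>, after which all terms vanish; the second conclusion keeps this alternative
  for later multiplications by \<open>\<rho> ^ K\<close>.\<close>

lemma geometric_decay:
  fixes E :: "nat \<Rightarrow> real"
  assumes nonneg: "\<And>k. 0 \<le> E k" and step: "\<And>k. E (Suc k) \<le> \<rho> * E k"
  shows "E K \<le> \<rho> ^ K * E 0" and "E 0 = 0 \<or> 0 \<le> \<rho>"
proof -
  show c: "E 0 = 0 \<or> 0 \<le> \<rho>"
    using order_trans[OF nonneg step, of 0] nonneg[of 0] by (auto simp: zero_le_mult_iff)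
  show "E K \<le> \<rho> ^ K * E 0"
  proof (cases "E 0 = 0")
    case True
    have "E k = 0" for k
    proof (induction k)
      case (Suc k)
      then show ?case using step[of k] nonneg[of "Suc k"] by simp
    qed (rule True)
    then show ?thesis by simp
  next
    case False
    then have "0 \<le> \<rho>" using c by simp
    then show ?thesis
    proof (induction K)
      case (Suc K)
      have "E (Suc K) \<le> \<rho> * E K" by (rule step)
      also have "\<dots> \<le> \<rho> * (\<rho> ^ K * E 0)"
        using Suc by (intro mult_left_mono) auto
      finally show ?case by (simp add: mult.assoc)
    qed simp
  qed
qed

theorem theorem2:
  fixes n :: nat
    and f :: "nat \<Rightarrow> real ^ 'd \<Rightarrow> real"
    and L :: "nat \<Rightarrow> real"
    and Lmax \<mu> \<gamma> \<epsilon>2 \<alpha> L\<gamma> S :: real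
    and M :: "real ^ 'd \<Rightarrow> real"
    and x :: "nat \<Rightarrow> real ^ 'd"
    and xt :: "nat \<Rightarrow> nat \<Rightarrow> real ^ 'd"
  assumes "n \<ge> 1"
    and "\<And>i y. i \<in> {1..n} \<Longrightarrow> f i differentiable (at y)"
    and "\<And>i. i \<in> {1..n} \<Longrightarrow> bdd_below (range (f i))"
    and "\<exists>y. \<forall>i\<in>{1..n}. gradient (f i) y = 0"
    and "\<And>i. i \<in> {1..n} \<Longrightarrow> convex_on UNIV (f i)"
    and "\<And>i. i \<in> {1..n} \<Longrightarrow> L i > 0"
    and "\<And>i. i \<in> {1..n} \<Longrightarrow> L_smooth (L i) (f i)"
    and "Lmax = Max (L ` {1..n})"
    and "\<mu> > 0"
    and "strongly_convex \<mu> (average n f)"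
    and "\<gamma> > 0"
    and "M = average n (\<lambda>i. moreau \<gamma> (f i))"
    and "L\<gamma> = smoothness_constant M"
    and "0 \<le> \<epsilon>2" and "\<epsilon>2 < \<mu>\<^sup>2 / (4 * Lmax\<^sup>2)"
    and "0 < \<alpha>"
    and "\<alpha> \<le> 1 / (\<gamma> * L\<gamma>) *
           ((\<mu> - 2 * sqrt \<epsilon>2 * Lmax) / (\<mu> + 4 * sqrt \<epsilon>2 * Lmax + 4 * \<epsilon>2 * Lmax))"
    and "\<And>k. x (Suc k) = x k + \<alpha> *\<^sub>R ((1 / real n) *\<^sub>R (\<Sum>i=1..n. xt i (Suc k)) - x k)"
    and "\<And>k i. i \<in> {1..n} \<Longrightarrow>
           (norm (xt i (Suc k) - prox \<gamma> (f i) (x k)))\<^sup>2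
             \<le> \<epsilon>2 * (norm (x k - prox \<gamma> (f i) (x k)))\<^sup>2"
    and "S = (\<mu> - 2 * sqrt \<epsilon>2 * Lmax) * (1 - 2 * sqrt \<epsilon>2 * (Lmax / \<mu>)) /
             (\<mu> + 4 * sqrt \<epsilon>2 * Lmax + 4 * \<epsilon>2 * Lmax)"
  shows "(\<forall>K. \<gamma> * M (x K) - \<gamma> * (INF y. M y)
               \<le> (1 - \<alpha> * (\<gamma> * (\<mu> - 2 * sqrt \<epsilon>2 * Lmax) / (4 * (1 + \<gamma> * Lmax)))) ^ K
                  * (\<gamma> * M (x 0) - \<gamma> * (INF y. M y)))
       \<and> (\<alpha> = 1 / (\<gamma> * L\<gamma>) *
              ((\<mu> - 2 * sqrt \<epsilon>2 * Lmax) / (\<mu> + 4 * sqrt \<epsilon>2 * Lmax + 4 * \<epsilon>2 * Lmax))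
          \<longrightarrow> (\<forall>xs. is_arg_min (average n f) (\<lambda>_. True) xs \<longrightarrow>
                (\<forall>K. (norm (x K - xs))\<^sup>2
                       \<le> (1 - \<mu> / (4 * L\<gamma> * (1 + \<gamma> * Lmax)) * S) ^ K
                          * (L\<gamma> * (1 + \<gamma> * Lmax) / \<mu>) * (norm (x 0 - xs))\<^sup>2)))
       \<and> 0 < S \<and> S \<le> 1"
proof -

  \<comment> \<open>Notation and the individual envelopes\<close>
  define m where "m = (\<lambda>i. moreau \<gamma> (f i))"
  define p where "p = (\<lambda>i. prox \<gamma> (f i))"
  define s where "s = sqrt \<epsilon>2"
  define G where "G = (\<lambda>y. (1 / real n) *\<^sub>R (\<Sum>i=1..n. y - p i y))"
  obtain w where w: "\<And>i. i \<in> {1..n} \<Longrightarrow> gradient (f i) w = 0" using assms(4) by blast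
  have s: "0 \<le> s" "s\<^sup>2 = \<epsilon>2" using assms(14) by (auto simp: s_def)
  have Lmax_ge: "L i \<le> Lmax" if "i \<in> {1..n}" for i
    using that assms(8) by simp
  have Lmax_pos: "0 < Lmax"
    using Lmax_ge[of 1] assms(6)[of 1] assms(1) by simp
  have M_def: "M = average n m" using assms(12) by (simp add: m_def)
  \<comment> \<open>The common constant \<open>Lmax\<close> replaces each \<open>L i\<close>, so
    that the estimates can be averaged.\<close>
  have sm: "smooth_moreau (f i) \<gamma> Lmax w" if "i \<in> {1..n}" for i
    using that assms(2,3,5,11) Lmax_pos w L_smooth_mono[OF assms(7)[OF that] Lmax_ge[OF that]]
    by unfold_locales blast+
  then have cm: "convex_moreau (f i) \<gamma>" if "i \<in> {1..n}" for i
    using that by (simp add: smooth_moreau_def)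
  have f_diff: "\<And>i z. i \<in> {1..n} \<Longrightarrow> f i differentiable (at z)" by (rule assms(2))
  have m_smooth: "L_smooth (1 / \<gamma>) (m i)" if "i \<in> {1..n}" for i
    unfolding m_def using convex_moreau.L_smooth_moreau[OF cm[OF that]] .
  then have m_diff: "\<And>i z. i \<in> {1..n} \<Longrightarrow> m i differentiable (at z)"
    by (simp add: L_smooth_def)
  have m_grad: "gradient (m i) y = (1 / \<gamma>) *\<^sub>R (y - p i y)" if "i \<in> {1..n}" for i y
    unfolding m_def p_def using convex_moreau.gradient_moreau[OF cm[OF that]] .

  \<comment> \<open>Gradient, convexity and smoothness of \<open>M\<close>\<close>
  have M_grad: "gradient M y = (1 / \<gamma>) *\<^sub>R G y" for y
  proof -
    have "gradient M y = (1 / real n) *\<^sub>R (\<Sum>i=1..n. gradient (m i) y)"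
      unfolding M_def using m_diff by (rule gradient_average)
    also have "(\<Sum>i=1..n. gradient (m i) y) = (\<Sum>i=1..n. (1 / \<gamma>) *\<^sub>R (y - p i y))"
      using m_grad by (intro sum.cong) auto
    finally show ?thesis by (simp add: G_def scaleR_sum_right mult.commute)
  qed
  have M_convex: "M y + inner (gradient M y) (z - y) \<le> M z" for y z
    unfolding M_def using m_diff
  proof (rule average_tangent_le)
    show "m i y + inner (gradient (m i) y) (z - y) \<le> m i z" if "i \<in> {1..n}" for i
      unfolding m_grad[OF that] unfolding m_def p_def
      using convex_moreau.moreau_lower[OF cm[OF that]] .
  qed
  have "L_smooth (1 / \<gamma>) M" unfolding M_def using assms(1) m_smooth by (rule L_smooth_average)
  from L_smooth_smoothness_constant[OF this M_convex]
  have M_smooth: "L_smooth L\<gamma> M" and "0 \<le> L\<gamma>" using assms(13) by auto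
  \<comment> \<open>For \<open>L\<gamma> = 0\<close> the division yields 0, and the upper bound on
    \<open>\<alpha>\<close> would contradict \<open>0 < \<alpha>\<close>.\<close>
  then have L\<gamma>: "0 < L\<gamma>" using assms(16,17) by (cases "L\<gamma> = 0") auto

  \<comment> \<open>The gap of \<open>M\<close> compared with the gap of the average and with the
    residuals\<close>
  have Mw: "M w = average n f w"
    unfolding M_def average_def m_def
    using smooth_moreau.moreau_minimizer[OF sm] by (auto intro!: sum.cong)
  have M_ge: "M w \<le> M y" for y
    unfolding Mw unfolding M_def
    by (rule average_mono) (simp add: m_def smooth_moreau.moreau_ge_min[OF sm])
  then have M_inf: "(INF y. M y) = M w"
    by (intro cInf_eq_minimum) auto
  have gap: "average n f y - average n f w \<le> (1 + \<gamma> * Lmax) * (M y - M w)" for y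
  proof -
    have "1 / real n * (\<Sum>i=1..n. f i y - f i w)
        \<le> 1 / real n * (\<Sum>i=1..n. (1 + \<gamma> * Lmax) * (m i y - f i w))"
      unfolding m_def using smooth_moreau.gap_le_moreau_gap[OF sm]
      by (intro mult_left_mono sum_mono) auto
    then show ?thesis
      unfolding Mw unfolding M_def
      by (simp add: average_def sum_subtractf sum_distrib_left[symmetric] diff_divide_distrib
          right_diff_distrib)
  qed
  have residual: "(1 + \<gamma> * Lmax) * (1 / real n * (\<Sum>i=1..n. (norm (y - p i y))\<^sup>2))
      \<le> 2 * Lmax * \<gamma>\<^sup>2 * (M y - M w)" for y
  proof -
    have "1 / real n * (\<Sum>i=1..n. (1 + \<gamma> * Lmax) * (norm (y - p i y))\<^sup>2)
        \<le> 1 / real n * (\<Sum>i=1..n. 2 * Lmax * \<gamma>\<^sup>2 * (m i y - f i w))"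
      unfolding m_def p_def using smooth_moreau.residual_le_moreau_gap[OF sm]
      by (intro mult_left_mono sum_mono) auto
    then show ?thesis
      unfolding Mw unfolding M_def
      by (simp add: average_def sum_subtractf sum_distrib_left[symmetric] diff_divide_distrib
          right_diff_distrib)
  qed

  \<comment> \<open>Quadratic bounds for the average around \<open>w\<close>\<close>
  have f_grad: "gradient (average n f) w = 0"
    using gradient_average[of n f w] f_diff w by simp
  have growth: "\<mu> / 2 * (norm (y - w))\<^sup>2 \<le> average n f y - average n f w" for y
    using assms(10) f_grad unfolding strongly_convex_def
    by (metis diff_zero inner_zero_left)
  have "L_smooth Lmax (average n f)"
    using assms(1) by (rule L_smooth_average) (use assms(7) Lmax_ge L_smooth_mono in blast)
  then have f_upper: "average n f y - average n f w \<le> Lmax / 2 * (norm (y - w))\<^sup>2" for y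
    using f_grad unfolding L_smooth_def by (metis diff_zero inner_zero_left)
  obtain b :: "real ^ 'd" where b: "norm b = 1" using nonempty_Basis norm_Basis by blast
  \<comment> \<open>The lower and upper quadratic bounds are compared at distance 1 from
    \<open>w\<close>.\<close>
  have \<mu>_le: "\<mu> \<le> Lmax"
    using order_trans[OF growth f_upper, of "w + b"] b by simp

  \<comment> \<open>Growth and gradient dominance of the scaled gap\<close>
  define q where "q = 1 + \<gamma> * Lmax"
  have q: "0 < q" using assms(11) Lmax_pos by (simp add: q_def add_pos_pos)
  \<comment> \<open>The factor \<open>\<gamma>\<close> makes the mean residual \<open>G\<close> the
    gradient of \<open>E\<close>.\<close>
  define E where "E = (\<lambda>y. \<gamma> * (M y - M w))"
  have E_nonneg: "0 \<le> E y" for y using M_ge assms(11) by (simp add: E_def)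
  have E_growth: "\<gamma> * \<mu> / q / 2 * (norm (y - w))\<^sup>2 \<le> E y" for y
  proof -
    have "\<gamma> * (\<mu> / 2 * (norm (y - w))\<^sup>2) \<le> \<gamma> * (q * (M y - M w))"
      unfolding q_def using order_trans[OF growth gap] assms(11) by (intro mult_left_mono) auto
    then show ?thesis using q by (simp add: E_def field_simps)
  qed
  have E_convex: "E y \<le> inner (G y) (y - w)" for y
  proof -
    have "M y - M w \<le> 1 / \<gamma> * inner (G y) (y - w)"
      using M_convex[of y w] by (simp add: M_grad inner_diff_right diff_divide_distrib)
    then show ?thesis using assms(11) by (simp add: E_def field_simps)
  qed
  have dominance: "\<gamma> * \<mu> / q * E y \<le> 2 * (norm (G y))\<^sup>2" for y
    using E_nonneg E_growth E_convex
    by (rule quadratic_growth_imp_gradient_dominance) (use q assms(9,11) in simp)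

  \<comment> \<open>Contraction factor and step size\<close>
  define \<rho> where "\<rho> = 1 - \<alpha> * (\<gamma> * (\<mu> - 2 * s * Lmax) / (4 * q))"
  have r: "0 < \<mu> - 2 * s * Lmax"
  proof -
    have "s\<^sup>2 < (\<mu> / (2 * Lmax))\<^sup>2"
      using assms(15) s by (simp add: power_divide power_mult_distrib)
    then have "s < \<mu> / (2 * Lmax)"
      by (rule power_less_imp_less_base) (use assms(9) Lmax_pos in simp)
    then show ?thesis using Lmax_pos by (simp add: field_simps)
  qed
  define D where "D = \<mu> + 4 * s * Lmax + 4 * s\<^sup>2 * Lmax"
  have D: "0 < D" "\<mu> \<le> D" using assms(9) s Lmax_pos by (auto simp: D_def intro!: add_pos_nonneg)
  have "\<alpha> \<le> 1 / (\<gamma> * L\<gamma>) * ((\<mu> - 2 * s * Lmax) / D)"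
    using assms(17) s by (simp add: D_def s_def)
  then have step_size: "\<alpha> * (\<gamma> * L\<gamma>) * D \<le> \<mu> - 2 * s * Lmax"
    using D L\<gamma> assms(11) by (simp add: field_simps)

  \<comment> \<open>Contraction in one iteration\<close>
  have E_step: "E (x (Suc k)) \<le> \<rho> * E (x k)" for k
  proof -
    let ?y = "x k"
    define e where "e = (1 / real n) *\<^sub>R (\<Sum>i=1..n. xt i (Suc k) - p i ?y)"
    have n: "(1 / real n) *\<^sub>R (\<Sum>i=1..n. ?y) = ?y"
      using assms(1) by (simp add: sum_constant_scaleR del: sum_constant)
    \<comment> \<open>The update is a gradient step of length \<open>\<alpha>\<close> on
      \<open>E\<close>, with gradient perturbed by \<open>e\<close>.\<close>
    have diff: "x (Suc k) - ?y = - (\<alpha> *\<^sub>R (G ?y - e))"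
      unfolding assms(18)[of k] G_def e_def sum_subtractf scaleR_diff_right n
      by (simp add: algebra_simps)
    have "(norm e)\<^sup>2 \<le> 1 / real n * (\<Sum>i=1..n. (norm (xt i (Suc k) - p i ?y))\<^sup>2)"
      unfolding e_def using assms(1) by (rule norm_mean_power2_le)
    also have "\<dots> \<le> 1 / real n * (\<Sum>i=1..n. \<epsilon>2 * (norm (?y - p i ?y))\<^sup>2)"
      unfolding p_def using assms(19) by (intro mult_left_mono sum_mono) auto
    also have "\<dots> = s\<^sup>2 * (1 / real n * (\<Sum>i=1..n. (norm (?y - p i ?y))\<^sup>2))"
      using s by (simp add: sum_distrib_left)
    \<comment> \<open>The mean squared residual is bounded by the gap, and the gap by the squared
      norm of \<open>G\<close>; the factor \<open>q\<close> cancels between the two.\<close>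
    also have "\<dots> \<le> s\<^sup>2 * (4 * Lmax / \<mu> * (norm (G ?y))\<^sup>2)"
    proof (rule mult_left_mono)
      let ?R = "1 / real n * (\<Sum>i=1..n. (norm (?y - p i ?y))\<^sup>2)"
      have "q * ?R * \<mu> \<le> 2 * Lmax * \<gamma>\<^sup>2 * (M ?y - M w) * \<mu>"
        unfolding q_def using residual[of ?y] assms(9) by (intro mult_right_mono) auto
      also have "\<dots> = 2 * Lmax * q * (\<gamma> * \<mu> / q * E ?y)"
        using q by (simp add: E_def power2_eq_square)
      also have "\<dots> \<le> 2 * Lmax * q * (2 * (norm (G ?y))\<^sup>2)"
        using dominance[of ?y] q Lmax_pos by (intro mult_left_mono) auto
      finally have "q * (?R * \<mu>) \<le> q * (4 * Lmax * (norm (G ?y))\<^sup>2)"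
        by (simp only: mult_ac)
      then have "?R * \<mu> \<le> 4 * Lmax * (norm (G ?y))\<^sup>2"
        using q by (simp only: mult_le_cancel_left_pos)
      then have "?R \<le> 4 * Lmax * (norm (G ?y))\<^sup>2 / \<mu>"
        using assms(9) by (simp only: pos_le_divide_eq)
      then show "?R \<le> 4 * Lmax / \<mu> * (norm (G ?y))\<^sup>2" by simp
    qed simp
    finally have err: "(norm e)\<^sup>2 \<le> s\<^sup>2 * (4 * Lmax / \<mu> * (norm (G ?y))\<^sup>2)" .
    have "M (x (Suc k)) - M ?y - inner (gradient M ?y) (x (Suc k) - ?y)
        \<le> L\<gamma> / 2 * (norm (x (Suc k) - ?y))\<^sup>2"
      using M_smooth unfolding L_smooth_def by blast
    then have "\<gamma> * (M (x (Suc k)) - M ?y - inner (gradient M ?y) (x (Suc k) - ?y))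
        \<le> \<gamma> * (L\<gamma> / 2 * (norm (x (Suc k) - ?y))\<^sup>2)"
      using assms(11) by (intro mult_left_mono) auto
    then have "E (x (Suc k)) - E ?y \<le> \<gamma> * L\<gamma> / 2 * (norm (\<alpha> *\<^sub>R (G ?y - e)))\<^sup>2
        - inner (G ?y) (\<alpha> *\<^sub>R (G ?y - e))"
      using assms(11) unfolding diff M_grad norm_minus_cancel inner_minus_right inner_scaleR_left
      by (simp add: E_def right_diff_distrib distrib_left)
    also have "\<dots> \<le> - (\<alpha> * (\<mu> - 2 * s * Lmax) / (2 * \<mu>) * (norm (G ?y))\<^sup>2)"
      using assms(9) \<mu>_le s(1) _ err
      by (rule inexact_gradient_step) (use assms(11,16) L\<gamma> step_size in \<open>simp_all add: D_def\<close>)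
    \<comment> \<open>The 2 of the step bound and the 2 of gradient dominance make up the 4 in
      \<open>\<rho>\<close>.\<close>
    also have "\<dots> \<le> - (\<alpha> * (\<mu> - 2 * s * Lmax) / (2 * \<mu>) * (\<gamma> * \<mu> / q * E ?y / 2))"
      using dominance[of ?y] assms(9,16) r by (intro le_imp_neg_le mult_left_mono) auto
    also have "\<dots> = (\<rho> - 1) * E ?y"
      using assms(9) q by (simp add: \<rho>_def field_simps)
    finally show ?thesis by (simp add: algebra_simps)
  qed

  \<comment> \<open>Decay of the gap, the range of \<open>S\<close> and the distance bound\<close>
  have decay: "E (x K) \<le> \<rho> ^ K * E (x 0)" and \<rho>: "E (x 0) = 0 \<or> 0 \<le> \<rho>" for K
    using geometric_decay[of "\<lambda>k. E (x k)", OF E_nonneg E_step] by auto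
  have "1 - 2 * s * (Lmax / \<mu>) = (\<mu> - 2 * s * Lmax) / \<mu>"
    using assms(9) by (simp add: diff_divide_distrib)
  then have "S = (\<mu> - 2 * s * Lmax) * ((\<mu> - 2 * s * Lmax) / \<mu>) / D"
    using assms(20) s by (simp add: s_def D_def)
  then have S_eq: "\<mu> * S = (\<mu> - 2 * s * Lmax)\<^sup>2 / D"
    using assms(9) by (simp add: power2_eq_square)
  have S: "0 < S" "S \<le> 1"
  proof -
    have "0 < \<mu> * S" unfolding S_eq using r D by simp
    then show "0 < S" using assms(9) by (simp add: zero_less_mult_iff)
    have "(\<mu> - 2 * s * Lmax)\<^sup>2 \<le> \<mu>\<^sup>2"
      using r s Lmax_pos by (intro power_mono) auto
    also have "\<dots> \<le> \<mu> * D" using D assms(9) by (simp add: power2_eq_square)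
    finally have "\<mu> * S \<le> \<mu> * 1" unfolding S_eq using D by (simp add: pos_divide_le_eq)
    then show "S \<le> 1" using assms(9) by simp
  qed
  have distance: "(norm (x K - xs))\<^sup>2
      \<le> (1 - \<mu> / (4 * L\<gamma> * q) * S) ^ K * (L\<gamma> * q / \<mu>) * (norm (x 0 - xs))\<^sup>2"
    if \<alpha>: "\<alpha> = 1 / (\<gamma> * L\<gamma>) * ((\<mu> - 2 * s * Lmax) / D)"
      and "is_arg_min (average n f) (\<lambda>_. True) xs" for xs K
  proof -
    \<comment> \<open>Quadratic growth around \<open>w\<close> makes \<open>w\<close> the only
      minimizer of the average.\<close>
    have "average n f xs \<le> average n f w" using that(2) by (simp add: is_arg_min_linorder)
    then have "\<mu> / 2 * (norm (xs - w))\<^sup>2 \<le> 0" using growth[of xs] by linarith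
    then have xs: "xs = w" using assms(9) by (simp add: mult_le_0_iff)
    \<comment> \<open>The maximal step size contributes one factor
      \<open>\<mu> - 2 * s * Lmax\<close> and the rate another; together they form the square in
      \<open>S_eq\<close>.\<close>
    have "\<alpha> * (\<gamma> * (\<mu> - 2 * s * Lmax) / (4 * q)) = \<mu> * S / (4 * L\<gamma> * q)"
      unfolding S_eq \<alpha> using assms(11) by (simp add: power2_eq_square)
    then have \<rho>_eq: "1 - \<mu> / (4 * L\<gamma> * q) * S = \<rho>" by (simp add: \<rho>_def)
    have "gradient M w = 0"
    proof -
      have "norm (gradient M w) ^ 2 \<le> 2 * L\<gamma> * (M w - M w)"
        using M_smooth L\<gamma> M_ge by (rule norm_gradient_le_gap)
      then show ?thesis by simp
    qed
    then have "M (x 0) - M w \<le> L\<gamma> / 2 * (norm (x 0 - w))\<^sup>2"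
      using M_smooth unfolding L_smooth_def by (metis diff_zero inner_zero_left)
    then have E0: "E (x 0) \<le> \<gamma> * (L\<gamma> / 2 * (norm (x 0 - w))\<^sup>2)"
      unfolding E_def using assms(11) by (intro mult_left_mono) auto
    \<comment> \<open>Multiplying \<open>E0\<close> by \<open>\<rho> ^ K\<close> requires a
      nonnegative power. That can fail only for \<open>E (x 0) = 0\<close>, when growth forces
      \<open>x 0 = w\<close> and both sides vanish.\<close>
    have "\<rho> ^ K * E (x 0) \<le> \<rho> ^ K * (\<gamma> * (L\<gamma> / 2 * (norm (x 0 - w))\<^sup>2))"
    proof (cases "E (x 0) = 0")
      case True
      then have "\<gamma> * \<mu> / q / 2 * (norm (x 0 - w))\<^sup>2 \<le> 0" using E_growth[of "x 0"] by simp
      then have "x 0 = w" using assms(9,11) q by (simp add: divide_le_0_iff mult_le_0_iff)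
      then show ?thesis using True by simp
    next
      case False
      then have "0 \<le> \<rho> ^ K" using \<rho> by simp
      then show ?thesis using E0 by (rule mult_left_mono[rotated])
    qed
    then have "\<gamma> * \<mu> / q / 2 * (norm (x K - w))\<^sup>2
        \<le> \<rho> ^ K * (\<gamma> * (L\<gamma> / 2 * (norm (x 0 - w))\<^sup>2))"
      using decay[of K] E_growth[of "x K"] by linarith
    \<comment> \<open>The prefactor \<open>L\<gamma> * q / \<mu>\<close> is the ratio of the
      quadratic constants bounding \<open>E\<close> from above and from below.\<close>
    also have "\<dots> = \<gamma> * \<mu> / q / 2 * (\<rho> ^ K * (L\<gamma> * q / \<mu>) * (norm (x 0 - w))\<^sup>2)"
      using q assms(9) by simp
    finally show ?thesis
      unfolding \<rho>_eq xs using q assms(9,11) by (simp only: mult_le_cancel_left_pos divide_pos_pos mult_pos_pos zero_less_numeral)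
  qed
  have E_eq: "\<gamma> * M y - \<gamma> * M w = E y" for y
    by (simp add: E_def right_diff_distrib)
  show ?thesis
    unfolding s_def[symmetric] M_inf E_eq unfolding s(2)[symmetric]
    unfolding D_def[symmetric] q_def[symmetric] \<rho>_def[symmetric]
    using decay distance S by blast
qed

end
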